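(* Let $s \ge 0$ be an integer, let $h \ge 1$ be an integer (the index of a subtree of the infinite labelled tree $\mathcal{F}_s$), and let $a_s(n)$ be the number of leaves among the first $n$ nodes of $\mathcal{F}_s$. (i) If $1 \le k \le 2^{h-1}-1$, then \[ a_s(2^h+(s-1)h+k+1) = 2^{h-2} + a_s(2^{h-1}+(s-1)h-s+k+1). \] (ii) If $1 \le k \le 2^{h-1}-1$, then \[ a_s(2^h+2^{h-1}+(s-1)h+k) = 2^{h-1} + a_s(2^{h-1}+(s-1)h-s+k+1). \] (iii) If $2^h+(s-1)h-s+1 \le n \le 2^h+(s-1)h+1$, then $a_s(n) = 2^{h-1}$.
   Context: For an integer $s \ge 0$, the infinite tree $\mathcal{F}_s$ is built as follows. It contains an initial single-node tree (one leaf); for each $h \ge 1$ a complete binary tree with $2^h-1$ nodes, called subtree $h$ (so the trees have sizes $1,1,3,7,15,\ldots$); and for each $h\ge 1$ a super-node $y_h$ consisting of $s$ ordinary nodes (no labelled nodes at all if $s=0$). The right child of $y_h$ is the root of subtree $h$; the left child of $y_h$ is $y_{h-1}$ if $h \ge 2$, and is the initial single-node tree if $h=1$. Labels $1,2,3,\ldots$ are given to the nodes in the following order: the initial single node, the $s$ nodes of $y_1$, the nodes of subtree $1$ in preorder, the $s$ nodes of $y_2$, the nodes of subtree $2$ in preorder, and so on. The leaves of $\mathcal{F}_s$ are the initial single node and the leaves of the subtrees $h\ge1$ (all at the bottom level); all other nodes, including those in super-nodes, are internal. For $n\ge 1$, $d_s(n)=1$ if node $n$ is a leaf and $d_s(n)=0$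 otherwise; $d_s(0)=0$. Then $a_s(n)=\sum_{j=0}^n d_s(j)$ is the number of leaves among nodes $1,\ldots,n$.
   Formalization: In (iii) the single value n = s+2 is excluded when h = 1: node s+2 is the only node of subtree 1 and is a leaf, so a_s(s+2) = 2, not 2^0 = 1. *)

theory Defs
  imports Main "HOL-Library.Tree"
begin

text \<open>The positions of the infinite tree: the initial single-node tree, the super-nodes
  \<open>y\<^sub>h\<close> (\<open>h \<ge> 1\<close>), and the nodes of subtree \<open>h\<close> (\<open>h \<ge> 1\<close>), a node being given by its path
  from the root of the subtree (\<open>False\<close> = left, \<open>True\<close> = right, length less than \<open>h\<close>).\<close>

datatype position = Initial | Super nat | Sub nat "bool list"

fun left_child :: "position \<Rightarrow> position option" where
  "left_child Initial = None"
| "left_child (Super h) = Some (if h \<ge> 2 then Super (h - 1) else Initial)"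
| "left_child (Sub h p) = (if length p + 1 < h then Some (Sub h (p @ [False])) else None)"

fun right_child :: "position \<Rightarrow> position option" where
  "right_child Initial = None"
| "right_child (Super h) = Some (Sub h [])"
| "right_child (Sub h p) = (if length p + 1 < h then Some (Sub h (p @ [True])) else None)"

definition leaf_position :: "position \<Rightarrow> bool" where
  "leaf_position v \<longleftrightarrow> left_child v = None \<and> right_child v = None"

text \<open>The binary tree hanging below a position, cut off after \<open>m\<close> levels. The constructor
  \<open>Leaf\<close> of the library type is the empty tree, not a leaf in the sense above.\<close>

fun tree_below :: "nat \<Rightarrow> position \<Rightarrow> position tree" where
  "tree_below 0 v = Leaf"
| "tree_below (Suc m) v =
     Node (case left_child v of None \<Rightarrow> Leaf | Some u \<Rightarrow> tree_below m u)
          v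
          (case right_child v of None \<Rightarrow> Leaf | Some u \<Rightarrow> tree_below m u)"

definition subtree :: "nat \<Rightarrow> position tree" where
  "subtree h = tree_below h (Sub h [])"

text \<open>An ordinary node is a position together with a number: the \<open>s\<close> ordinary nodes that
  make up \<open>y\<^sub>h\<close> are \<open>(Super h, 0), \<dots>, (Super h, s - 1)\<close>, every other position carries the single
  ordinary node numbered \<open>0\<close>. The list below consists of the initial node and the nodes of
  \<open>y\<^sub>1\<close>, subtree \<open>1\<close>, \dots, \<open>y\<^sub>H\<close>, subtree \<open>H\<close> in the order of labelling.\<close>

fun labelled_upto :: "nat \<Rightarrow> nat \<Rightarrow> (position \<times> nat) list" where
  "labelled_upto s 0 = [(Initial, 0)]"
| "labelled_upto s (Suc h) =
     labelled_upto s h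
     @ map (\<lambda>i. (Super (Suc h), i)) [0..<s]
     @ map (\<lambda>v. (v, 0)) (preorder (subtree (Suc h)))"

text \<open>The node with label \<open>n \<ge> 1\<close>. Any list that is long enough gives the same node, see
  \<open>node_eq\<close>; the one for \<open>H = n\<close> always is.\<close>

definition node :: "nat \<Rightarrow> nat \<Rightarrow> position \<times> nat" where
  "node s n = labelled_upto s n ! (n - 1)"

definition leaf_ind :: "nat \<Rightarrow> nat \<Rightarrow> nat" where
  "leaf_ind s n = (if n \<ge> 1 \<and> leaf_position (fst (node s n)) then 1 else 0)"

definition leaf_count :: "nat \<Rightarrow> nat \<Rightarrow> nat" where
  "leaf_count s n = (\<Sum>j = 0..n. leaf_ind s j)"

lemma tree_below_Sub:
  "length p + m = h \<Longrightarrow>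
     complete (tree_below m (Sub h p)) \<and> height (tree_below m (Sub h p)) = m"
proof (induction m arbitrary: p)
  case 0
  then show ?case by simp
next
  case (Suc m)
  show ?case
  proof (cases "m = 0")
    case True
    with Suc.prems show ?thesis by simp
  next
    case False
    with Suc.prems have "length p + 1 < h" by simp
    with Suc.IH[of "p @ [False]"] Suc.IH[of "p @ [True]"] Suc.prems show ?thesis
      by simp
  qed
qed

lemma complete_subtree: "complete (subtree h)"
  and height_subtree: "height (subtree h) = h"
  using tree_below_Sub[of "[]" h h] by (simp_all add: subtree_def)

lemma size_subtree: "size (subtree h) = 2 ^ h - 1"
  using size_if_complete[OF complete_subtree] by (simp add: height_subtree)

lemma length_labelled_upto: "h < length (labelled_upto s h)"
proof (induction h)
  case 0
  then show ?case by simp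
next
  case (Suc h)
  have "1 \<le> size (subtree (Suc h))"
    by (simp add: subtree_def)
  with Suc show ?case by simp
qed

lemma labelled_upto_prefix: "h \<le> h' \<Longrightarrow> \<exists>xs. labelled_upto s h' = labelled_upto s h @ xs"
  by (induction rule: dec_induct) auto

lemma node_eq:
  assumes "1 \<le> n" and "n \<le> length (labelled_upto s h)"
  shows "node s n = labelled_upto s h ! (n - 1)"
proof -
  have n: "n - 1 < length (labelled_upto s n)" "n - 1 < length (labelled_upto s h)"
    using length_labelled_upto[of n s] assms by linarith+
  show ?thesis
  proof (cases "h \<le> n")
    case True
    then obtain xs where "labelled_upto s n = labelled_upto s h @ xs"
      using labelled_upto_prefix by blast
    then show ?thesis using n by (simp add: node_def nth_append)
  next
    case False
    then obtain xs where "labelled_upto s h = labelled_upto s n @ xs"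
      using labelled_upto_prefix[of n h s] by auto
    then show ?thesis using n by (simp add: node_def nth_append)
  qed
qed

text \<open>Subtree \<open>1\<close> consists of a single node, its root, with label \<open>s + 2\<close>. This root is a leaf,
  whereas the roots of all other subtrees are internal.\<close>

lemma leaf_count_root_subtree_1: "leaf_count s (s + 2) = 2"
proof -
  have l: "labelled_upto s 1
      = (Initial, 0) # map (\<lambda>i. (Super 1, i)) [0..<s] @ [(Sub 1 [], 0)]"
    by (simp add: subtree_def)
  have "leaf_ind s j = (if j = 1 \<or> j = s + 2 then 1 else 0)" if "j \<le> s + 2" for j
  proof (cases "j = 0")
    case True
    then show ?thesis by (simp add: leaf_ind_def)
  next
    case False
    then have "node s j = labelled_upto s 1 ! (j - 1)"
      using that by (intro node_eq) (simp_all add: l del: One_nat_def)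
    moreover obtain i where "j = Suc i" using False by (cases j) auto
    ultimately show ?thesis
      using that unfolding l
      by (auto simp: leaf_ind_def leaf_position_def nth_append nth_Cons split: nat.splits)
  qed
  then have "leaf_count s (s + 2) = (\<Sum>j = 0..s + 2. if j = 1 \<or> j = s + 2 then 1 else 0)"
    unfolding leaf_count_def by (intro sum.cong) auto
  also have "\<dots> = (\<Sum>j \<in> {1, s + 2}. if j = 1 \<or> j = s + 2 then 1 else 0)"
    by (rule sum.mono_neutral_right) auto
  finally show ?thesis by simp
qed

end

theory Submission
  imports Defs
begin

text \<open>In preorder, the leaves of a complete binary tree of height \<open>m + 1\<close> follow a pattern that
  depends on \<open>m\<close> only: the root, then twice the pattern for height \<open>m\<close>. Parts (i) and (ii) compare
  a prefix of the first and of the second half of subtree \<open>h\<close> with the same prefix of subtree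
  \<open>h - 1\<close>, the leaves before a subtree being a power of two in number; in (iii) only internal
  nodes are passed.\<close>

fun leaf_pattern :: "nat \<Rightarrow> bool list" where
  "leaf_pattern 0 = []"
| "leaf_pattern (Suc m) = (m = 0) # leaf_pattern m @ leaf_pattern m"

lemma length_leaf_pattern: "length (leaf_pattern m) = 2 ^ m - 1"
proof -
  \<comment> \<open>The successor form keeps truncated subtraction out of the induction.\<close>
  have "Suc (length (leaf_pattern m)) = 2 ^ m" by (induction m) simp_all
  then show ?thesis by simp
qed

lemma count_leaf_pattern: "count_list (leaf_pattern (Suc m)) True = 2 ^ m"
proof (induction m)
  case (Suc m)
  then show ?case
    by (subst leaf_pattern.simps) (simp del: leaf_pattern.simps)
qed simp

text \<open>Whether a node is a leaf depends only on how many levels remain below its path, so both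
  children yield the same pattern; hence the induction over arbitrary \<open>p\<close>.\<close>

lemma leaf_pattern_tree_below:
  "length p + m = h \<Longrightarrow>
     map leaf_position (preorder (tree_below m (Sub h p))) = leaf_pattern m"
proof (induction m arbitrary: p)
  case (Suc m)
  show ?case
  proof (cases "m = 0")
    case True
    with Suc.prems show ?thesis by (simp add: leaf_position_def)
  next
    case False
    with Suc.prems Suc.IH[of "p @ [False]"] Suc.IH[of "p @ [True]"] show ?thesis
      by (simp add: leaf_position_def)
  qed
qed simp

definition leaf_sequence :: "nat \<Rightarrow> nat \<Rightarrow> bool list" where
  "leaf_sequence s h = map (\<lambda>x. leaf_position (fst x)) (labelled_upto s h)"

lemma length_leaf_sequence: "length (leaf_sequence s h) = length (labelled_upto s h)"
  by (simp add: leaf_sequence_def)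

lemma leaf_sequence_0: "leaf_sequence s 0 = [True]"
  by (simp add: leaf_sequence_def leaf_position_def)

lemma leaf_sequence_Suc:
  "leaf_sequence s (Suc g) = leaf_sequence s g @ replicate s False @ leaf_pattern (Suc g)"
proof -
  have "map (\<lambda>i. leaf_position (Super (Suc g))) [0..<s] = replicate s False"
    by (rule nth_equalityI) (simp_all add: leaf_position_def)
  moreover have "map leaf_position (preorder (subtree (Suc g))) = leaf_pattern (Suc g)"
    unfolding subtree_def by (rule leaf_pattern_tree_below) simp
  ultimately show ?thesis
    by (simp add: leaf_sequence_def comp_def del: leaf_pattern.simps)
qed

text \<open>By \<open>node_eq\<close>, every sufficiently long finite stage carries the same labels,
  so counting can be done in whichever stage \<open>h\<close> is convenient.\<close>

lemma leaf_count_eq: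
  "n \<le> length (labelled_upto s h) \<Longrightarrow>
     leaf_count s n = count_list (take n (leaf_sequence s h)) True"
proof (induction n)
  case 0
  then show ?case by (simp add: leaf_count_def leaf_ind_def)
next
  case (Suc n)
  then have "node s (Suc n) = labelled_upto s h ! n"
    using node_eq[of "Suc n" s h] by simp
  moreover have "leaf_count s (Suc n) = leaf_count s n + leaf_ind s (Suc n)"
    by (simp add: leaf_count_def)
  ultimately show ?case
    using Suc by (simp add: take_Suc_conv_app_nth leaf_ind_def leaf_sequence_def)
qed

text \<open>Super-nodes add no leaves, and subtree \<open>Suc g\<close> adds \<open>2 ^ g\<close>,
  as many as precede it, so each stage doubles the count.\<close>

lemma count_leaf_sequence:
  "count_list (leaf_sequence s g) True = 2 ^ g"
proof (induction g)
  case 0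
  then show ?case by (simp add: leaf_sequence_0)
next
  case (Suc g)
  have "count_list (replicate s False) True = 0" by (simp add: count_list_0_iff)
  then show ?case
    by (simp add: leaf_sequence_Suc Suc.IH count_leaf_pattern
        del: leaf_pattern.simps labelled_upto.simps)
qed

text \<open>Stated over the integers because \<open>s - 1\<close> is negative for
  \<open>s = 0\<close>.\<close>

lemma int_length_labelled_upto:
  "int (length (labelled_upto s g)) = 2 ^ Suc g + (int s - 1) * int g - 1"
proof (induction g)
  case (Suc g)
  have "int (size (subtree (Suc g))) = 2 ^ Suc g - 1"
    unfolding size_subtree by (simp add: of_nat_diff)
  with Suc show ?case by (simp add: algebra_simps)
qed simp

lemma leaf_count_super:
  assumes "r \<le> s"
  shows "leaf_count s (length (labelled_upto s g) + r) = 2 ^ g"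
proof -
  have "count_list (take r (replicate s False)) True = 0" by (simp add: count_list_0_iff)
  then show ?thesis
    using assms leaf_count_eq[of "length (labelled_upto s g) + r" s "Suc g"]
    unfolding leaf_sequence_Suc
    by (simp add: count_leaf_sequence length_leaf_sequence del: leaf_pattern.simps)
qed

lemma leaf_count_subtree:
  assumes "m < 2 ^ Suc g"
  shows "leaf_count s (length (labelled_upto s g) + s + m)
    = 2 ^ g + count_list (take m (leaf_pattern (Suc g))) True"
proof -
  have "count_list (replicate s False) True = 0" by (simp add: count_list_0_iff)
  then show ?thesis
    using assms leaf_count_eq[of "length (labelled_upto s g) + s + m" s "Suc g"]
    unfolding leaf_sequence_Suc
    by (simp add: count_leaf_sequence length_leaf_sequence size_subtree del: leaf_pattern.simps)
qed

text \<open>The extra node is the root, internal at height \<open>g + 2\<close>; the next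
  \<open>k\<close> nodes repeat the start of subtree \<open>Suc g\<close>. Only the leaves before
  the two subtrees differ, by \<open>2 ^ Suc g - 2 ^ g = 2 ^ g\<close>.\<close>

lemma leaf_count_left_half:
  assumes "k < 2 ^ Suc g"
  shows "leaf_count s (length (labelled_upto s (Suc g)) + s + Suc k)
    = 2 ^ g + leaf_count s (length (labelled_upto s g) + s + k)"
proof -
  have "Suc k < 2 ^ Suc (Suc g)" using assms by simp
  moreover have "take (Suc k) (leaf_pattern (Suc (Suc g))) = False # take k (leaf_pattern (Suc g))"
    using assms length_leaf_pattern[of "Suc g"] by (subst leaf_pattern.simps) (simp del: leaf_pattern.simps)
  ultimately show ?thesis
    using assms leaf_count_subtree[of "Suc k" "Suc g" s] leaf_count_subtree[of k g s]
    by (simp del: leaf_pattern.simps labelled_upto.simps)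
qed

text \<open>The root and the whole left half make up the \<open>2 ^ Suc g\<close> extra nodes and
  hold \<open>2 ^ g\<close> leaves; the leaves before the two subtrees account for another
  \<open>2 ^ g\<close>.\<close>

lemma leaf_count_right_half:
  assumes "k < 2 ^ Suc g"
  shows "leaf_count s (length (labelled_upto s (Suc g)) + s + (2 ^ Suc g + k))
    = 2 ^ Suc g + leaf_count s (length (labelled_upto s g) + s + k)"
proof -
  have "2 ^ Suc g + k < 2 ^ Suc (Suc g)" using assms by simp
  moreover have "take (2 ^ Suc g + k) (leaf_pattern (Suc (Suc g)))
      = False # leaf_pattern (Suc g) @ take k (leaf_pattern (Suc g))"
  proof -
    have "2 ^ Suc g + k = Suc (length (leaf_pattern (Suc g)) + k)"
      unfolding length_leaf_pattern by simp
    then show ?thesis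
      by (subst leaf_pattern.simps) (simp del: leaf_pattern.simps power_Suc)
  qed
  ultimately show ?thesis
    using assms
    by (simp add: leaf_count_subtree count_leaf_pattern del: leaf_pattern.simps labelled_upto.simps)
qed

theorem theorem2p6:
  fixes s h :: nat
  assumes "h \<ge> 1"
  shows
    "(\<forall>k::nat. 1 \<le> k \<and> k \<le> 2 ^ (h - 1) - 1 \<longrightarrow>
        leaf_count s (nat (2 ^ h + (int s - 1) * int h + int k + 1))
          = 2 ^ (h - 2) + leaf_count s (nat (2 ^ (h - 1) + (int s - 1) * int h - int s + int k + 1)))
     \<and> (\<forall>k::nat. 1 \<le> k \<and> k \<le> 2 ^ (h - 1) - 1 \<longrightarrow>
        leaf_count s (nat (2 ^ h + 2 ^ (h - 1) + (int s - 1) * int h + int k))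
          = 2 ^ (h - 1) + leaf_count s (nat (2 ^ (h - 1) + (int s - 1) * int h - int s + int k + 1)))
     \<and> (\<forall>n::nat. 2 ^ h + (int s - 1) * int h - int s + 1 \<le> int n
           \<and> int n \<le> 2 ^ h + (int s - 1) * int h + 1
           \<and> (h = 1 \<longrightarrow> n \<noteq> s + 2) \<longrightarrow>
        leaf_count s n = 2 ^ (h - 1))"
proof -
  obtain g where h: "h = Suc g" using assms by (cases h) auto
  \<comment> \<open>The three arguments of the theorem are rewritten as positions counted from the
    start of a subtree: subtree \<open>h\<close> for the first two, subtree \<open>h - 1\<close> for
    the last.\<close>
  have labels:
    "2 ^ h + (int s - 1) * int h + int k + 1
       = int (length (labelled_upto s (Suc f)) + s + Suc k)"
    "2 ^ h + 2 ^ (h - 1) + (int s - 1) * int h + int k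
       = int (length (labelled_upto s (Suc f)) + s + (2 ^ Suc f + k))"
    "2 ^ (h - 1) + (int s - 1) * int h - int s + int k + 1
       = int (length (labelled_upto s f) + s + k)"
    if "g = Suc f" for f k
    unfolding of_nat_add
    using int_length_labelled_upto[of s f] int_length_labelled_upto[of s "Suc f"]
    by (simp_all add: h that algebra_simps del: labelled_upto.simps)
  have halves:
    "leaf_count s (nat (2 ^ h + (int s - 1) * int h + int k + 1))
       = 2 ^ (h - 2) + leaf_count s (nat (2 ^ (h - 1) + (int s - 1) * int h - int s + int k + 1))"
    "leaf_count s (nat (2 ^ h + 2 ^ (h - 1) + (int s - 1) * int h + int k))
       = 2 ^ (h - 1) + leaf_count s (nat (2 ^ (h - 1) + (int s - 1) * int h - int s + int k + 1))"
    if k: "1 \<le> k" "k \<le> 2 ^ (h - 1) - 1" for k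
  proof -
    \<comment> \<open>For \<open>h = 1\<close> no \<open>k\<close> is in range, so
      \<open>h \<ge> 2\<close> and \<open>h - 2\<close> is the true difference
      \<open>f\<close>.\<close>
    obtain f where f: "g = Suc f" using k h by (cases g) auto
    with k h have "k < 2 ^ Suc f" by simp
    then show
      "leaf_count s (nat (2 ^ h + (int s - 1) * int h + int k + 1))
         = 2 ^ (h - 2) + leaf_count s (nat (2 ^ (h - 1) + (int s - 1) * int h - int s + int k + 1))"
      "leaf_count s (nat (2 ^ h + 2 ^ (h - 1) + (int s - 1) * int h + int k))
         = 2 ^ (h - 1) + leaf_count s (nat (2 ^ (h - 1) + (int s - 1) * int h - int s + int k + 1))"
      using leaf_count_left_half[of k f s] leaf_count_right_half[of k f s]
      unfolding labels[OF f] nat_int by (simp_all add: h f del: labelled_upto.simps)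
  qed
  have "leaf_count s n = 2 ^ (h - 1)"
    if n: "2 ^ h + (int s - 1) * int h - int s + 1 \<le> int n"
      "int n \<le> 2 ^ h + (int s - 1) * int h + 1" "h = 1 \<longrightarrow> n \<noteq> s + 2" for n
  proof -
    \<comment> \<open>The range for \<open>n\<close> begins right after subtree \<open>h - 1\<close>
      (the initial node if \<open>h = 1\<close>): it covers the \<open>s\<close> nodes of
      \<open>y_h\<close> and the root of subtree \<open>h\<close>.\<close>
    have start: "2 ^ h + (int s - 1) * int h - int s = int (length (labelled_upto s g))"
      unfolding int_length_labelled_upto h by (simp add: algebra_simps)
    define r where "r = n - length (labelled_upto s g)"
    have r: "n = length (labelled_upto s g) + r" "r \<le> s + 1"
      using n(1,2) start unfolding r_def by linarith+
    show ?thesis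
    proof (cases "r \<le> s")
      case True
      then show ?thesis using leaf_count_super r h by simp
    next
      case False
      with r have r: "n = length (labelled_upto s g) + s + 1" by simp
      \<comment> \<open>Here \<open>n\<close> labels the root of subtree \<open>h\<close>. For
        \<open>g = 0\<close> this would be \<open>s + 2\<close>, the excluded leaf; otherwise the
        root is internal.\<close>
      have "g \<noteq> 0" using n(3) r h by (cases g) auto
      moreover have "1 < (2::nat) ^ Suc g" by (rule one_less_power) simp_all
      ultimately show ?thesis
        using leaf_count_subtree[of 1 g s] r h by simp
    qed
  qed
  with halves show ?thesis by blast
qed

end
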